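(* Let $N\ge 1$ be an integer, let $x_0,\ldots,x_{N-1}\in\mathbb{R}$ be the Gauss--Hermite quadrature nodes of degree $N$ (the $N$ roots of the Hermite function $\psi_N$), and let $J\in\mathbb{R}^{N\times N}$ be the Jacobi matrix with entries, for $i,j=0,1,\ldots,N-1$, $$J_{i,j}=\begin{cases}\sqrt{\dfrac{j}{2}}, & j=i+1,\\[2mm] \sqrt{\dfrac{i}{2}}, & i=j+1,\\[1mm] 0, & \text{otherwise.}\end{cases}$$ Then $J$ has the eigendecomposition $$J = Q\Lambda Q^T,$$ where $\Lambda=\mathrm{diag}(x_0,\ldots,x_{N-1})$ and $Q\in\mathbb{R}^{N\times N}$ is the orthogonal matrix with entries $$Q_{kj}=\frac{\psi_k(x_j)}{\sqrt{N}\,|\psi_{N-1}(x_j)|},\qquad 0\le k,j\le N-1.$$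
   Context: All matrix and vector indices run from $0$ to $N-1$. The Hermite polynomials $\mathrm{H}_n$ are defined by $\mathrm{H}_0(x)=1$, $\mathrm{H}_1(x)=2x$, and $\mathrm{H}_{n+1}(x)=2x\,\mathrm{H}_n(x)-2n\,\mathrm{H}_{n-1}(x)$ for $n\ge 1$. The Hermite functions are $\psi_n(x)=(2^n n!\sqrt{\pi})^{-1/2}\,\mathrm{e}^{-x^2/2}\,\mathrm{H}_n(x)$ for $n\ge 0$; they form an orthonormal basis of $L^2(\mathbb{R})$ and satisfy $\psi_{n+1}(x)=\sqrt{\tfrac{2}{n+1}}\,x\,\psi_n(x)-\sqrt{\tfrac{n}{n+1}}\,\psi_{n-1}(x)$. The Gauss--Hermite quadrature nodes of degree $N$ are the $N$ distinct real roots of $\psi_N$ (equivalently of $\mathrm{H}_N$), enumerated as $x_0,\ldots,x_{N-1}$. *)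

theory Defs
  imports Complex_Main "Jordan_Normal_Form.Matrix"
begin

text \<open>Physicists' normalisation: the leading coefficient of \<open>hermite n\<close> is \<open>2 ^ n\<close>.\<close>

fun hermite :: "nat \<Rightarrow> real \<Rightarrow> real" where
  "hermite 0 x = 1"
| "hermite (Suc 0) x = 2 * x"
| "hermite (Suc (Suc n)) x = 2 * x * hermite (Suc n) x - 2 * real (Suc n) * hermite n x"

definition hermite_fun :: "nat \<Rightarrow> real \<Rightarrow> real" where
  "hermite_fun n x = (2 ^ n * fact n * sqrt pi) powr (- (1 / 2)) * exp (- (x ^ 2) / 2) * hermite n x"

text \<open>The values of \<open>x\<close> at \<open>0, \<dots>, N - 1\<close> list the real roots of the Hermite function of degree
  \<open>N\<close>, each exactly once and in an arbitrary order.\<close>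

definition gauss_hermite_nodes :: "nat \<Rightarrow> (nat \<Rightarrow> real) \<Rightarrow> bool" where
  "gauss_hermite_nodes N x \<longleftrightarrow> bij_betw x {..<N} {t. hermite_fun N t = 0}"

definition hermite_jacobi_mat :: "nat \<Rightarrow> real mat" where
  "hermite_jacobi_mat N = mat N N (\<lambda>(i, j).
     if j = i + 1 then sqrt (real j / 2)
     else if i = j + 1 then sqrt (real i / 2)
     else 0)"

definition gauss_hermite_Q :: "nat \<Rightarrow> (nat \<Rightarrow> real) \<Rightarrow> real mat" where
  "gauss_hermite_Q N x = mat N N (\<lambda>(k, j).
     hermite_fun k (x j) / (sqrt (real N) * \<bar>hermite_fun (N - 1) (x j)\<bar>))"

definition real_orthogonal_mat :: "nat \<Rightarrow> real mat \<Rightarrow> bool" where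
  "real_orthogonal_mat N A \<longleftrightarrow> A \<in> carrier_mat N N \<and>
     transpose_mat A * A = 1\<^sub>m N \<and> A * transpose_mat A = 1\<^sub>m N"

end

theory Submission
  imports Defs "Jordan_Normal_Form.Determinant"
begin

text \<open>
  The Hermite functions satisfy the symmetric three-term recurrence
  \<open>x \<psi>\<^sub>k(x) = sqrt ((k + 1) / 2) \<psi>\<^sub>k\<^sub>+\<^sub>1(x) + sqrt (k / 2) \<psi>\<^sub>k\<^sub>-\<^sub>1(x)\<close>, whose coefficients are the
  entries of the Jacobi matrix. Applying that matrix to the vector \<open>(\<psi>\<^sub>0(x), \<dots>, \<psi>\<^sub>N\<^sub>-\<^sub>1(x))\<close>
  therefore multiplies it by \<open>x\<close>, except that the last component lacks the term in
  \<open>\<psi>\<^sub>N(x)\<close>. At a node this term is zero, so the columns of \<open>gauss_hermite_Q\<close> are eigenvectors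
  (\<open>hermite_jacobi_mat_eigenvectors\<close>).

  Their orthonormality comes from two forms of the Christoffel--Darboux formula. For two distinct
  nodes, \<open>christoffel_darboux_hermite_fun\<close> makes the inner product of the two vectors vanish. On the
  diagonal, \<open>christoffel_darboux_hermite_fun_confluent\<close> evaluates the squared length of the
  vector at a node as \<open>N \<psi>\<^sub>N\<^sub>-\<^sub>1(x)\<^sup>2\<close>, which is exactly the square of the denominator in
  \<open>gauss_hermite_Q\<close>. It is positive because \<open>\<psi>\<^sub>0\<close> has no zeros. Thus \<open>Q\<^sup>T Q = 1\<close>; as \<open>Q\<close> is square
  also \<open>Q Q\<^sup>T = 1\<close>, and \<open>J Q = Q \<Lambda>\<close> turns into the eigendecomposition.
\<close>

text \<open>Rescaling the recurrence of the Hermite polynomials gives equal weights to the step up from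
  \<open>n\<close> and the step down from \<open>n + 1\<close>: the normalising constants \<open>c\<close> satisfy
  \<open>c (n + 1) * sqrt (2 * (n + 1)) = c n\<close>. At \<open>n = 0\<close> the truncated index \<open>n - 1\<close> is harmless, because its coefficient vanishes.\<close>

lemma hermite_fun_three_term:
  "x * hermite_fun n x =
     sqrt (real (Suc n) / 2) * hermite_fun (Suc n) x + sqrt (real n / 2) * hermite_fun (n - 1) x"
proof -
  define c where "c m = (2 ^ m * fact m * sqrt pi) powr (- (1 / 2))" for m
  have c_Suc: "c (Suc m) * sqrt (2 * real (Suc m)) = c m" for m
  proof -
    have "c (Suc m) = (2 * real (Suc m) * (2 ^ m * fact m * sqrt pi)) powr (- (1 / 2))"
      unfolding c_def by (simp add: algebra_simps)
    also have "\<dots> = (2 * real (Suc m)) powr (- (1 / 2)) * c m"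
      unfolding c_def by (subst powr_mult) auto
    also have "(2 * real (Suc m)) powr (- (1 / 2)) = 1 / sqrt (2 * real (Suc m))"
      by (subst powr_minus, subst powr_half_sqrt) (auto simp: field_simps)
    finally show ?thesis by simp
  qed
  have psi: "hermite_fun m x = c m * exp (- (x ^ 2) / 2) * hermite m x" for m
    unfolding hermite_fun_def c_def ..
  have half: "sqrt (real (Suc m) / 2) = sqrt (2 * real (Suc m)) / 2" for m
    by (rule real_sqrt_unique) (simp_all add: power_divide)
  have raise: "sqrt (real (Suc m) / 2) * c (Suc m) = c m / 2" for m
    unfolding half c_Suc[of m, symmetric] by simp
  show ?thesis
  proof (cases n)
    case 0
    then show ?thesis
      using raise[of 0] by (simp add: psi)
  next
    case (Suc m)
    have lower: "sqrt (real (Suc m) / 2) * c m = real (Suc m) * c (Suc m)"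
    proof -
      have "sqrt (real (Suc m) / 2) * c m
          = sqrt (real (Suc m) / 2) * sqrt (2 * real (Suc m)) * c (Suc m)"
        unfolding c_Suc[of m, symmetric] by (simp only: mult_ac)
      also have "sqrt (real (Suc m) / 2) * sqrt (2 * real (Suc m)) = real (Suc m)"
        by (simp only: half) simp
      finally show ?thesis .
    qed
    define e where "e = exp (- (x ^ 2) / 2)"
    have "sqrt (real (Suc n) / 2) * hermite_fun (Suc n) x + sqrt (real n / 2) * hermite_fun (n - 1) x
        = (sqrt (real (Suc n) / 2) * c (Suc n)) * e * hermite (Suc n) x
          + (sqrt (real (Suc m) / 2) * c m) * e * hermite m x"
      by (simp add: psi Suc e_def)
    also have "\<dots> = c n / 2 * e * hermite (Suc n) x + real (Suc m) * c n * e * hermite m x"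
      by (simp only: raise lower Suc)
    also have "\<dots> = x * (c n * e * hermite n x)"
      unfolding Suc by (simp add: field_simps)
    finally show ?thesis by (simp add: psi e_def)
  qed
qed

text \<open>Expanding \<open>x \<psi>\<^sub>k(x) \<psi>\<^sub>k(y) - \<psi>\<^sub>k(x) y \<psi>\<^sub>k(y)\<close> by the three-term recurrence gives the difference
  of the right-hand sides for \<open>k\<close> and \<open>k - 1\<close>, so the sum telescopes.\<close>

lemma christoffel_darboux_hermite_fun:
  "(x - y) * (\<Sum>k\<le>n. hermite_fun k x * hermite_fun k y) =
     sqrt (real (Suc n) / 2) *
       (hermite_fun (Suc n) x * hermite_fun n y - hermite_fun n x * hermite_fun (Suc n) y)"
proof (induction n)
  case 0
  show ?case
    using hermite_fun_three_term[of x 0] hermite_fun_three_term[of y 0]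
    by (simp add: algebra_simps)
next
  case (Suc n)
  let ?p = "hermite_fun"
  have "(x - y) * (\<Sum>k\<le>Suc n. ?p k x * ?p k y)
      = (x - y) * (\<Sum>k\<le>n. ?p k x * ?p k y)
        + (x * ?p (Suc n) x) * ?p (Suc n) y - ?p (Suc n) x * (y * ?p (Suc n) y)"
    by (simp add: algebra_simps)
  also have "\<dots> = sqrt (real (Suc (Suc n)) / 2) *
       (?p (Suc (Suc n)) x * ?p (Suc n) y - ?p (Suc n) x * ?p (Suc (Suc n)) y)"
    unfolding Suc.IH hermite_fun_three_term[of _ "Suc n"] by (simp add: algebra_simps)
  finally show ?case .
qed

text \<open>This is the limit \<open>y \<rightarrow> x\<close> of the previous formula, with the derivatives that appear there
  eliminated by \<open>\<psi>\<^sub>n'(x) = - x \<psi>\<^sub>n(x) + sqrt (2 n) \<psi>\<^sub>n\<^sub>-\<^sub>1(x)\<close>. In this derivative-free form it follows from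
  the three-term recurrence alone, by induction. The truncated index at \<open>n = 0\<close> again has
  coefficient zero.\<close>

lemma christoffel_darboux_hermite_fun_confluent:
  "(\<Sum>k\<le>n. (hermite_fun k x)\<^sup>2) =
     real (Suc n) * (hermite_fun n x)\<^sup>2
     - sqrt (real (Suc n) * real n) * hermite_fun (Suc n) x * hermite_fun (n - 1) x"
proof (induction n)
  case 0
  show ?case by simp
next
  case (Suc n)
  define a b where "a = sqrt (real (Suc (Suc n)) / 2)" and "b = sqrt (real (Suc n) / 2)"
  define d where "d = sqrt (real n / 2)"
  define p q r s where "p = hermite_fun (Suc (Suc n)) x" and "q = hermite_fun (Suc n) x"
    and "r = hermite_fun n x" and "s = hermite_fun (n - 1) x"
  have up: "a * p = x * q - b * r"
    using hermite_fun_three_term[of x "Suc n"] by (simp add: a_def b_def p_def q_def r_def)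
  have down: "d * s = x * r - b * q"
    using hermite_fun_three_term[of x n] by (simp add: b_def d_def q_def r_def s_def)
  have bb: "2 * (b * b) = real (Suc n)"
    by (simp add: b_def)
  have ab: "sqrt (real (Suc (Suc n)) * real (Suc n)) = 2 * (a * b)"
    unfolding a_def b_def real_sqrt_mult real_sqrt_divide by (simp add: field_simps)
  have bd: "sqrt (real (Suc n) * real n) = 2 * (b * d)"
    unfolding d_def b_def real_sqrt_mult real_sqrt_divide by (simp add: field_simps)
  have "(\<Sum>k\<le>Suc n. (hermite_fun k x)\<^sup>2)
      = real (Suc n) * r\<^sup>2 - 2 * b * q * (d * s) + q\<^sup>2"
    using Suc.IH unfolding bd by (simp add: q_def r_def s_def)
  \<comment> \<open>Eliminating \<open>s\<close> on the left and \<open>p\<close> on the right leaves an identity in \<open>q\<close> and \<open>r\<close>.\<close>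
  also have "\<dots> = real (Suc (Suc n)) * q\<^sup>2 - 2 * b * r * (a * p)"
    unfolding up down of_nat_Suc[of "Suc n"] bb[symmetric]
    by (simp add: algebra_simps power2_eq_square)
  finally show ?case
    unfolding ab by (simp add: p_def q_def r_def mult_ac)
qed

lemma hermite_fun_0_pos: "hermite_fun 0 x > 0"
  by (simp add: hermite_fun_def)

lemma hermite_fun_orthogonal_at_roots:
  assumes "hermite_fun (Suc n) x = 0" "hermite_fun (Suc n) y = 0" "x \<noteq> y"
  shows "(\<Sum>k\<le>n. hermite_fun k x * hermite_fun k y) = 0"
  using christoffel_darboux_hermite_fun[of x y n] assms by simp

lemma sum_hermite_fun_squares_at_root:
  assumes "hermite_fun (Suc n) x = 0"
  shows "(\<Sum>k\<le>n. (hermite_fun k x)\<^sup>2) = real (Suc n) * (hermite_fun n x)\<^sup>2"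
  using christoffel_darboux_hermite_fun_confluent[of x n] assms by simp

text \<open>A common zero of two consecutive Hermite functions would make all the lower ones vanish,
  including \<open>\<psi>\<^sub>0\<close>, which is a multiple of a Gaussian. This keeps the denominators in
  \<open>gauss_hermite_Q\<close> away from zero.\<close>

lemma hermite_fun_nonzero_at_next_root:
  assumes "hermite_fun (Suc n) x = 0"
  shows "hermite_fun n x \<noteq> 0"
proof
  assume "hermite_fun n x = 0"
  then have "(\<Sum>k\<le>n. (hermite_fun k x)\<^sup>2) = 0"
    using sum_hermite_fun_squares_at_root[OF assms] by simp
  then have "(hermite_fun 0 x)\<^sup>2 = 0"
    by (subst (asm) sum_nonneg_eq_0_iff) auto
  then show False
    using hermite_fun_0_pos[of x] by simp
qed

lemma gauss_hermite_Q_gram: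
  assumes "gauss_hermite_nodes N x" "i < N" "j < N"
  shows "(\<Sum>k<N. gauss_hermite_Q N x $$ (k, i) * gauss_hermite_Q N x $$ (k, j))
    = (if i = j then 1 else 0)"
proof -
  obtain n where N: "N = Suc n"
    using \<open>i < N\<close> by (cases N) auto
  have root: "hermite_fun (Suc n) (x l) = 0" if "l < N" for l
    using assms(1) that unfolding gauss_hermite_nodes_def bij_betw_def N by blast
  define w where "w l = sqrt (real N) * \<bar>hermite_fun n (x l)\<bar>" for l
  have "(\<Sum>k<N. gauss_hermite_Q N x $$ (k, i) * gauss_hermite_Q N x $$ (k, j))
      = (\<Sum>k\<le>n. hermite_fun k (x i) * hermite_fun k (x j)) / (w i * w j)"
    unfolding sum_divide_distrib
    by (rule sum.cong) (use assms(2,3) in \<open>auto simp: gauss_hermite_Q_def w_def N\<close>)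
  also have "\<dots> = (if i = j then 1 else 0)"
  proof (cases "i = j")
    case True
    have "(\<Sum>k\<le>n. hermite_fun k (x i) * hermite_fun k (x i)) = w i * w i"
      using sum_hermite_fun_squares_at_root[OF root[OF \<open>i < N\<close>]]
      by (simp add: w_def N power2_eq_square mult_ac)
    moreover have "w i \<noteq> 0"
      using hermite_fun_nonzero_at_next_root[OF root[OF \<open>i < N\<close>]] by (simp add: w_def N)
    ultimately show ?thesis
      using True by simp
  next
    case False
    then have "x i \<noteq> x j"
      using assms unfolding gauss_hermite_nodes_def bij_betw_def inj_on_def by blast
    then show ?thesis
      using hermite_fun_orthogonal_at_roots[of n "x i" "x j"] root assms False by simp
  qed
  finally show ?thesis .
qed

lemma gauss_hermite_Q_orthogonal:
  assumes "gauss_hermite_nodes N x"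
  shows "real_orthogonal_mat N (gauss_hermite_Q N x)"
proof -
  let ?Q = "gauss_hermite_Q N x"
  have Q: "?Q \<in> carrier_mat N N"
    by (simp add: gauss_hermite_Q_def)
  have QTQ: "transpose_mat ?Q * ?Q = 1\<^sub>m N"
    using Q gauss_hermite_Q_gram[OF assms]
    by (intro eq_matI) (auto simp: scalar_prod_def lessThan_atLeast0)
  have "?Q * transpose_mat ?Q = 1\<^sub>m N"
    by (rule mat_mult_left_right_inverse[OF _ Q QTQ]) (use Q in simp)
  then show ?thesis
    using Q QTQ by (simp add: real_orthogonal_mat_def)
qed

text \<open>The condition \<open>f N = 0\<close> makes the truncated matrix act like the infinite tridiagonal one: the
  entry that is cut off in the last row would multiply \<open>f N\<close>.\<close>

lemma hermite_jacobi_mat_row_sum: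
  assumes "k < N" "f N = 0"
  shows "(\<Sum>i<N. hermite_jacobi_mat N $$ (k, i) * f i)
    = sqrt (real (Suc k) / 2) * f (Suc k) + sqrt (real k / 2) * f (k - 1)"
proof -
  have "(\<Sum>i<N. hermite_jacobi_mat N $$ (k, i) * f i)
      = (\<Sum>i<N. (if i = Suc k then sqrt (real (Suc k) / 2) * f (Suc k) else 0)
          + (if i = k - 1 then sqrt (real k / 2) * f (k - 1) else 0))"
    using assms by (intro sum.cong) (auto simp: hermite_jacobi_mat_def)
  also have "\<dots> = (if Suc k < N then sqrt (real (Suc k) / 2) * f (Suc k) else 0)
      + sqrt (real k / 2) * f (k - 1)"
    using assms by (simp add: sum.distrib)
  also have "\<dots> = sqrt (real (Suc k) / 2) * f (Suc k) + sqrt (real k / 2) * f (k - 1)"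
    using assms by (cases "Suc k = N") auto
  finally show ?thesis .
qed

lemma hermite_jacobi_mat_eigenvectors:
  assumes "gauss_hermite_nodes N x"
  shows "hermite_jacobi_mat N * gauss_hermite_Q N x = gauss_hermite_Q N x * mat_diag N x"
proof (rule eq_matI)
  let ?J = "hermite_jacobi_mat N" and ?Q = "gauss_hermite_Q N x"
  have J: "?J \<in> carrier_mat N N" and Q: "?Q \<in> carrier_mat N N"
    by (simp_all add: hermite_jacobi_mat_def gauss_hermite_Q_def)
  show "dim_row (?J * ?Q) = dim_row (?Q * mat_diag N x)"
    and "dim_col (?J * ?Q) = dim_col (?Q * mat_diag N x)"
    using J Q by (auto simp: mat_diag_def)
  fix k j
  assume "k < dim_row (?Q * mat_diag N x)" "j < dim_col (?Q * mat_diag N x)"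
  then have kj: "k < N" "j < N"
    using Q by (auto simp: mat_diag_def)
  define f where "f i = hermite_fun i (x j) / (sqrt (real N) * \<bar>hermite_fun (N - 1) (x j)\<bar>)" for i
  have "hermite_fun N (x j) = 0"
    using assms kj unfolding gauss_hermite_nodes_def bij_betw_def by blast
  then have "f N = 0"
    by (simp add: f_def)
  have Q_f: "?Q $$ (i, j) = f i" if "i < N" for i
    using that kj by (simp add: gauss_hermite_Q_def f_def)
  have "(?J * ?Q) $$ (k, j) = (\<Sum>i<N. ?J $$ (k, i) * ?Q $$ (i, j))"
    using J Q kj by (simp add: scalar_prod_def lessThan_atLeast0)
  also have "\<dots> = (\<Sum>i<N. ?J $$ (k, i) * f i)"
    by (simp add: Q_f)
  also have "\<dots> = sqrt (real (Suc k) / 2) * f (Suc k) + sqrt (real k / 2) * f (k - 1)"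
    by (rule hermite_jacobi_mat_row_sum) fact+
  also have "\<dots> = x j * f k"
    using hermite_fun_three_term[of "x j" k] by (simp add: f_def add_divide_distrib)
  also have "\<dots> = (?Q * mat_diag N x) $$ (k, j)"
    using Q kj by (simp add: mat_diag_mult_right Q_f)
  finally show "(?J * ?Q) $$ (k, j) = (?Q * mat_diag N x) $$ (k, j)" .
qed

theorem lemma2p2:
  fixes N :: nat and x :: "nat \<Rightarrow> real"
  assumes "N \<ge> 1"
    and "gauss_hermite_nodes N x"
  shows "real_orthogonal_mat N (gauss_hermite_Q N x) \<and>
    hermite_jacobi_mat N =
      gauss_hermite_Q N x * mat_diag N x * transpose_mat (gauss_hermite_Q N x)"
proof
  let ?J = "hermite_jacobi_mat N" and ?Q = "gauss_hermite_Q N x"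
  show orth: "real_orthogonal_mat N ?Q"
    by (rule gauss_hermite_Q_orthogonal) fact
  have J: "?J \<in> carrier_mat N N"
    by (simp add: hermite_jacobi_mat_def)
  have Q: "?Q \<in> carrier_mat N N" and QQT: "?Q * transpose_mat ?Q = 1\<^sub>m N"
    using orth by (simp_all add: real_orthogonal_mat_def)
  have "?J = ?J * (?Q * transpose_mat ?Q)"
    using J by (simp add: QQT)
  also have "\<dots> = ?J * ?Q * transpose_mat ?Q"
    using J Q by (simp add: assoc_mult_mat[of _ N N _ N _ N])
  also have "\<dots> = ?Q * mat_diag N x * transpose_mat ?Q"
    by (simp only: hermite_jacobi_mat_eigenvectors[OF assms(2)])
  finally show "?J = ?Q * mat_diag N x * transpose_mat ?Q" .
qed

end
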